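(* Let $D\subset(\mathbb Z_{\ge 0})^2$ be a Young diagram and let $\overline{D}=(\mathbb Z_{\ge 0})^2\setminus D$. Let $a$ and $l$ be non-negative integers. Then the number of boxes $c\in D$ such that $a(c)=a$ and $l(c)=l$ is one less than the number of boxes $c\in\overline{D}$ such that $a(c)=a$ and $l(c)=l$.
   Context: A Young diagram is a finite subset $D\subset(\mathbb Z_{\ge 0})^2$ such that if $(x,y)\in D$, $0\le x'\le x$ and $0\le y'\le y$, then $(x',y')\in D$. Elements of $(\mathbb Z_{\ge 0})^2$ are called boxes; the first coordinate is horizontal (increasing to the east), the second is vertical (increasing to the north). Arm and leg lengths. For $c=(x,y)\in D$: $a(c)$ is the number of boxes $(x',y)\in D$ with $x'>x$, and $l(c)$ is the number of boxes $(x,y')\in D$ with $y'>y$. For $c=(x,y)\in\overline{D}$: $a(c)$ is the number of boxes $(x',y)\in\overline{D}$ with $0\le x'<x$, and $l(c)$ is the number of boxes $(x,y')\in\overline{D}$ with $0\le y'<y$. *)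

theory Defs
  imports Main
begin

text \<open>Boxes are elements of \<^typ>\<open>nat \<times> nat\<close>: first coordinate horizontal (to the east),
  second coordinate vertical (to the north).\<close>

definition young_diagram :: "(nat \<times> nat) set \<Rightarrow> bool" where
  "young_diagram D \<longleftrightarrow>
     finite D \<and> (\<forall>x y x' y'. (x, y) \<in> D \<and> x' \<le> x \<and> y' \<le> y \<longrightarrow> (x', y') \<in> D)"

text \<open>For a box outside \<open>D\<close>, arm and leg are measured in the complement, towards the west
  and the south.\<close>

definition arm :: "(nat \<times> nat) set \<Rightarrow> nat \<times> nat \<Rightarrow> nat" where
  "arm D c = (case c of (x, y) \<Rightarrow>
     if (x, y) \<in> D then card {(x', y) | x'. (x', y) \<in> D \<and> x' > x}
     else card {(x', y) | x'. (x', y) \<in> - D \<and> x' < x})"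

definition leg :: "(nat \<times> nat) set \<Rightarrow> nat \<times> nat \<Rightarrow> nat" where
  "leg D c = (case c of (x, y) \<Rightarrow>
     if (x, y) \<in> D then card {(x, y') | y'. (x, y') \<in> D \<and> y' > y}
     else card {(x, y') | y'. (x, y') \<in> - D \<and> y' < y})"

end

theory Submission
  imports Defs
begin

text \<open>Let \<open>r y\<close> be the length of the \<open>y\<close>-th row and put \<open>P z \<longleftrightarrow> r z \<le> r (z + l) + a\<close> and
  \<open>Q z \<longleftrightarrow> r z \<le> r (z + l + 1) + a\<close>. A box with arm \<open>a\<close> is determined by its row, and its leg is \<open>l\<close>
  iff \<open>P z \<and> \<not> Q z\<close> for a box of \<open>D\<close> in row \<open>z\<close>, and iff \<open>P z \<and> (z = 0 \<or> \<not> Q (z - 1))\<close> for a box of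
  the complement in row \<open>z + l\<close>. Since \<open>Q z\<close> implies both \<open>P z\<close> and \<open>P (z + 1)\<close>, the difference of the
  two counts telescopes to the value of \<open>Q\<close> far away, which is true.\<close>

text \<open>With truth values read as 0 and 1, the hypotheses turn
  \<open>P z \<and> \<not> Q z\<close> into \<open>P z\<close> minus \<open>Q z\<close> and, for
  positive \<open>z\<close>, \<open>P z \<and> \<not> Q (z - 1)\<close> into \<open>P z\<close>
  minus \<open>Q (z - 1)\<close>. Summed up to \<open>n\<close>, the two differ by
  \<open>Q n\<close> only.\<close>

lemma card_shifted_minus_card:
  fixes P Q :: "nat \<Rightarrow> bool"
  assumes "\<And>z. Q z \<Longrightarrow> P z" and "\<And>z. Q z \<Longrightarrow> P (Suc z)"
  shows "card {z. z \<le> n \<and> P z \<and> (z = 0 \<or> \<not> Q (z - 1))}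
           = card {z. z \<le> n \<and> P z \<and> \<not> Q z} + of_bool (Q n)"
proof (induction n)
  case 0
  have "{z. z \<le> 0 \<and> P z \<and> (z = 0 \<or> \<not> Q (z - 1))} = (if P 0 then {0} else {})"
    and "{z. z \<le> 0 \<and> P z \<and> \<not> Q z} = (if P 0 \<and> \<not> Q 0 then {0} else {})"
    by (auto intro: gr0I)
  then show ?case
    using assms(1)[of 0] by auto
next
  case (Suc n)
  have step: "card {z. z \<le> Suc n \<and> R z} = card {z. z \<le> n \<and> R z} + of_bool (R (Suc n))" for R
  proof -
    have "{z. z \<le> Suc n \<and> R z} = {z. z \<le> n \<and> R z} \<union> (if R (Suc n) then {Suc n} else {})"
      by (auto simp: le_Suc_eq)
    then show ?thesis by simp
  qed
  show ?case
    using Suc.IH assms(1)[of "Suc n"] assms(2)[of n]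
      step[of "\<lambda>z. P z \<and> (z = 0 \<or> \<not> Q (z - 1))"] step[of "\<lambda>z. P z \<and> \<not> Q z"]
    by auto
qed

lemma down_closed_eq_lessThan_card:
  fixes A :: "nat set"
  assumes "finite A" and "\<And>x y. x \<in> A \<Longrightarrow> y \<le> x \<Longrightarrow> y \<in> A"
  shows "A = {..<card A}"
proof -
  define m where "m = (LEAST m. m \<notin> A)"
  have m: "m \<notin> A"
    unfolding m_def using LeastI_ex[of "\<lambda>m. m \<notin> A"] ex_new_if_finite[OF infinite_UNIV_nat assms(1)]
    by blast
  have "x \<in> A" if "x < m" for x
    using that not_less_Least unfolding m_def by blast
  then have "A = {..<m}"
    using m assms(2) by (auto simp: not_less[symmetric])
  then show ?thesis by (metis card_lessThan)
qed

definition row_length :: "(nat \<times> nat) set \<Rightarrow> nat \<Rightarrow> nat" where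
  "row_length D y = card {x. (x, y) \<in> D}"

definition col_length :: "(nat \<times> nat) set \<Rightarrow> nat \<Rightarrow> nat" where
  "col_length D x = card {y. (x, y) \<in> D}"

context
  fixes D :: "(nat \<times> nat) set"
  assumes young: "young_diagram D"
begin

lemma mem_iff_less_row_length: "(x, y) \<in> D \<longleftrightarrow> x < row_length D y"
proof -
  have "finite {x. (x, y) \<in> D}"
    using young finite_surj[of D "{x. (x, y) \<in> D}" fst]
    by (force simp: young_diagram_def)
  then have "{x. (x, y) \<in> D} = {..<row_length D y}"
    unfolding row_length_def
    using young by (intro down_closed_eq_lessThan_card) (auto simp: young_diagram_def)
  then show ?thesis by auto
qed

lemma mem_iff_less_col_length: "(x, y) \<in> D \<longleftrightarrow> y < col_length D x"
proof -
  have "finite {y. (x, y) \<in> D}"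
    using young finite_surj[of D "{y. (x, y) \<in> D}" snd]
    by (force simp: young_diagram_def)
  then have "{y. (x, y) \<in> D} = {..<col_length D x}"
    unfolding col_length_def
    using young by (intro down_closed_eq_lessThan_card) (auto simp: young_diagram_def)
  then show ?thesis by auto
qed

lemma arm_eq:
  "arm D (x, y) = (if (x, y) \<in> D then row_length D y - Suc x else x - row_length D y)"
proof -
  have "{(x', y) | x'. (x', y) \<in> D \<and> x' > x} = (\<lambda>x'. (x', y)) ` {x<..<row_length D y}"
    and "{(x', y) | x'. (x', y) \<in> - D \<and> x' < x} = (\<lambda>x'. (x', y)) ` {row_length D y..<x}"
    by (auto simp: mem_iff_less_row_length)
  then show ?thesis
    unfolding arm_def by (simp add: card_image inj_on_def)
qed

lemma leg_eq:
  "leg D (x, y) = (if (x, y) \<in> D then col_length D x - Suc y else y - col_length D x)"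
proof -
  have "{(x, y') | y'. (x, y') \<in> D \<and> y' > y} = (\<lambda>y'. (x, y')) ` {y<..<col_length D x}"
    and "{(x, y') | y'. (x, y') \<in> - D \<and> y' < y} = (\<lambda>y'. (x, y')) ` {col_length D x..<y}"
    by (auto simp: mem_iff_less_col_length)
  then show ?thesis
    unfolding leg_def by (simp add: card_image inj_on_def)
qed

text \<open>Leg \<open>l\<close> means that \<open>(x, y + l)\<close> is the top box of
  \<open>D\<close> in column \<open>x\<close>. Row lengths express this because boxes will be
  counted by rows.\<close>

lemma leg_eq_iff_inside:
  assumes "(x, y) \<in> D"
  shows "leg D (x, y) = l \<longleftrightarrow> row_length D (y + l + 1) \<le> x \<and> x < row_length D (y + l)"
proof -
  have "leg D (x, y) = l \<longleftrightarrow> (x, y + l + 1) \<notin> D \<and> (x, y + l) \<in> D"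
    using assms unfolding leg_eq mem_iff_less_col_length by auto
  then show ?thesis by (simp add: mem_iff_less_row_length not_less)
qed

text \<open>The witness \<open>z\<close> is the height of column \<open>x\<close>, the row of its
  lowest box outside \<open>D\<close>; \<open>z = 0\<close> covers an empty column.\<close>

lemma leg_eq_iff_outside:
  assumes "(x, y) \<notin> D"
  shows "leg D (x, y) = l \<longleftrightarrow>
    (\<exists>z. y = z + l \<and> row_length D z \<le> x \<and> (z = 0 \<or> x < row_length D (z - 1)))"
proof -
  have "leg D (x, y) = l \<longleftrightarrow> (\<exists>z. y = z + l \<and> (x, z) \<notin> D \<and> (z = 0 \<or> (x, z - 1) \<in> D))"
    (is "_ \<longleftrightarrow> ?R")
  proof
    assume "leg D (x, y) = l"
    then have "y = col_length D x + l"
      using assms unfolding leg_eq mem_iff_less_col_length by auto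
    then show ?R
      unfolding mem_iff_less_col_length by (intro exI[of _ "col_length D x"]) auto
  next
    assume ?R
    then show "leg D (x, y) = l"
      using assms unfolding leg_eq mem_iff_less_col_length by auto
  qed
  then show ?thesis by (simp add: mem_iff_less_row_length not_less)
qed

lemma row_length_antimono:
  assumes "y \<le> y'"
  shows "row_length D y' \<le> row_length D y"
proof (rule ccontr)
  assume "\<not> ?thesis"
  then have "(row_length D y, y') \<in> D"
    by (simp add: mem_iff_less_row_length)
  then have "(row_length D y, y) \<in> D"
    using young assms unfolding young_diagram_def by blast
  then show False by (simp add: mem_iff_less_row_length)
qed

lemma inside_eq_image:
  "{c \<in> D. arm D c = a \<and> leg D c = l} =
   (\<lambda>z. (row_length D z - Suc a, z)) ` {z. row_length D z \<le> row_length D (z + l) + a \<and>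
      \<not> row_length D z \<le> row_length D (z + l + 1) + a}" (is "?L = ?f ` ?Z")
proof
  show "?L \<subseteq> ?f ` ?Z"
  proof
    fix c assume c: "c \<in> ?L"
    obtain x y where xy: "c = (x, y)" by (cases c)
    have D: "(x, y) \<in> D" using c xy by simp
    have x: "x < row_length D y" using D by (simp add: mem_iff_less_row_length)
    have "row_length D y = x + a + 1"
      using c xy D x by (auto simp: arm_eq)
    then show "c \<in> ?f ` ?Z"
      using c xy leg_eq_iff_inside[OF D, of l] by (intro image_eqI[of _ _ y]) auto
  qed
next
  show "?f ` ?Z \<subseteq> ?L"
  proof
    fix c assume "c \<in> ?f ` ?Z"
    then obtain z where z: "z \<in> ?Z" "c = ?f z" by blast
    \<comment> \<open>The negated inequality in \<open>?Z\<close> forces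
      \<open>row_length D z \<ge> Suc a\<close>, so the subtraction is not truncated.\<close>
    have D: "(row_length D z - Suc a, z) \<in> D"
      using z by (auto simp: mem_iff_less_row_length)
    then show "c \<in> ?L"
      using z leg_eq_iff_inside[OF D, of l] by (auto simp: arm_eq)
  qed
qed

text \<open>Indexing by the column height \<open>z\<close> instead of the row \<open>z + l\<close>
  of the box makes the first condition the same as in \<open>inside_eq_image\<close>.\<close>

lemma outside_eq_image:
  "{c \<in> - D. arm D c = a \<and> leg D c = l} =
   (\<lambda>z. (row_length D (z + l) + a, z + l)) ` {z. row_length D z \<le> row_length D (z + l) + a \<and>
      (z = 0 \<or> \<not> row_length D (z - 1) \<le> row_length D (z - 1 + l + 1) + a)}" (is "?L = ?f ` ?Z")
proof -
  \<comment> \<open>For positive \<open>z\<close> this identifies the row length in the last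
    condition with that of the box's own row; at \<open>z = 0\<close> truncation breaks the
    equation.\<close>
  have shift: "z = 0 \<or> z - 1 + l + 1 = z + l" for z :: nat by auto
  show ?thesis
  proof
    show "?L \<subseteq> ?f ` ?Z"
    proof
      fix c assume c: "c \<in> ?L"
      obtain x y where xy: "c = (x, y)" by (cases c)
      have D: "(x, y) \<notin> D" using c xy by simp
      then have x: "x = row_length D y + a"
        using c xy by (auto simp: arm_eq mem_iff_less_row_length)
      obtain z where "y = z + l" "row_length D z \<le> x" "z = 0 \<or> x < row_length D (z - 1)"
        using c xy leg_eq_iff_outside[OF D, of l] by auto
      then show "c \<in> ?f ` ?Z"
        using x xy shift[of z] by (intro image_eqI[of _ _ z]) auto
    qed
  next
    show "?f ` ?Z \<subseteq> ?L"
    proof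
      fix c assume "c \<in> ?f ` ?Z"
      then obtain z where z: "z \<in> ?Z" "c = ?f z" by blast
      have D: "(row_length D (z + l) + a, z + l) \<notin> D"
        by (simp add: mem_iff_less_row_length)
      then have "leg D c = l"
        using z shift[of z] leg_eq_iff_outside[OF D, of l] by auto
      then show "c \<in> ?L"
        using z D by (auto simp: arm_eq)
    qed
  qed
qed

lemma ex_row_length_eq_0: "\<exists>n. \<forall>y \<ge> n. row_length D y = 0"
proof (intro exI allI impI)
  \<comment> \<open>The witness is the height of the first column: a row whose first box is outside
    \<open>D\<close> is empty.\<close>
  fix y assume "col_length D 0 \<le> y"
  then have "(0, y) \<notin> D" by (simp add: mem_iff_less_col_length)
  then show "row_length D y = 0" by (simp add: mem_iff_less_row_length)
qed

end

theorem theorem1p3: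
  fixes D :: "(nat \<times> nat) set" and a l :: nat
  assumes "young_diagram D"
  shows "finite {c \<in> - D. arm D c = a \<and> leg D c = l} \<and>
         card {c \<in> - D. arm D c = a \<and> leg D c = l}
           = card {c \<in> D. arm D c = a \<and> leg D c = l} + 1"
proof -
  let ?r = "row_length D"
  define P where "P z \<longleftrightarrow> ?r z \<le> ?r (z + l) + a" for z
  define Q where "Q z \<longleftrightarrow> ?r z \<le> ?r (z + l + 1) + a" for z
  obtain n where n: "\<And>y. y \<ge> n \<Longrightarrow> ?r y = 0"
    using ex_row_length_eq_0[OF assms] by blast
  \<comment> \<open>Rows shrink upwards: \<open>Q z\<close> yields \<open>P z\<close> by enlarging
    the right side, and \<open>P (Suc z)\<close> by shrinking the left side, as
    \<open>z + l + 1 = Suc z + l\<close>.\<close>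
  have QP: "P z" if "Q z" for z
    using that row_length_antimono[OF assms, of "z + l" "z + l + 1"] by (simp add: P_def Q_def)
  have QP_Suc: "P (Suc z)" if "Q z" for z
    using that row_length_antimono[OF assms, of z "Suc z"] by (simp add: P_def Q_def)
  have Q_far: "Q z" if "z \<ge> n" for z
    using n[OF that] by (simp add: Q_def)
  have in_eq: "{z. P z \<and> \<not> Q z} = {z. z \<le> n \<and> P z \<and> \<not> Q z}"
    using Q_far nat_le_linear by auto
  \<comment> \<open>Failure of \<open>Q (z - 1)\<close> gives \<open>z - 1 < n\<close>, so the bound
    \<open>n\<close> still suffices after the shift by one.\<close>
  have "z \<le> n" if "z = 0 \<or> \<not> Q (z - 1)" for z
    using that Q_far[of "z - 1"] by linarith
  then have out_eq: "{z. P z \<and> (z = 0 \<or> \<not> Q (z - 1))}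
      = {z. z \<le> n \<and> P z \<and> (z = 0 \<or> \<not> Q (z - 1))}"
    by auto
  have inside: "{c \<in> D. arm D c = a \<and> leg D c = l}
      = (\<lambda>z. (?r z - Suc a, z)) ` {z. z \<le> n \<and> P z \<and> \<not> Q z}"
    unfolding in_eq[symmetric] unfolding inside_eq_image[OF assms] P_def Q_def ..
  have outside: "{c \<in> - D. arm D c = a \<and> leg D c = l}
      = (\<lambda>z. (?r (z + l) + a, z + l)) ` {z. z \<le> n \<and> P z \<and> (z = 0 \<or> \<not> Q (z - 1))}"
    unfolding out_eq[symmetric] unfolding outside_eq_image[OF assms] P_def Q_def ..
  \<comment> \<open>The surplus box is the boundary term \<open>Q n\<close>, which is true.\<close>
  have "card {z. z \<le> n \<and> P z \<and> (z = 0 \<or> \<not> Q (z - 1))} = card {z. z \<le> n \<and> P z \<and> \<not> Q z} + 1"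
    using card_shifted_minus_card[of Q P n] QP QP_Suc Q_far[of n] by simp
  \<comment> \<open>Both parametrizations are injective, since the second coordinate recovers
    \<open>z\<close>.\<close>
  then show ?thesis
    unfolding inside outside by (simp add: card_image inj_on_def)
qed

end
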